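(* For all integers $m\ge t\ge 0$, the number of $(102,000)$-avoiding inversion sequences $e$ (of any length) with $\operatorname{dist}(e)=m$ and $\operatorname{rank}(e)=t$ equals $$\frac{3t+1}{3m+1}\binom{4m-t}{m-t}.$$ In particular, the number of $(102,000)$-avoiding inversion sequences $e$ with $\operatorname{dist}(e)=m$ and $\operatorname{rank}(e)=0$ is the $3$-Fuss–Catalan number $\frac{1}{3m+1}\binom{4m}{m}$.
   Context: An inversion sequence of length $n$ is an integer sequence $e=(e_1,\dots,e_n)$ with $0\le e_j\le j-1$ for all $j$. It is $(102,000)$-avoiding if there are no indices $i<j<k$ with $e_j<e_i<e_k$ and no indices $i<j<k$ with $e_i=e_j=e_k$. $\operatorname{dist}(e)$ is the number of distinct entries of $e$ (such $e$ has length between $m$ and $2m$ when $\operatorname{dist}(e)=m$). For such $e$ of length $n\ge1$, let $p$ be the least index with $e_1\le\dots\le e_p>e_{p+1}$, with the convention $e_{n+1}=-1$, and set $\operatorname{rank}(e):=(p-1)-e_p$. By convention the empty sequence (length $0$) is included, with $\operatorname{dist}=\operatorname{rank}=0$. *)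

theory Defs
  imports Complex_Main
begin

text \<open>
  A sequence \<open>(e_1, \<dots>, e_n)\<close> is an \<open>int list\<close>; \<open>entry e j\<close> is its \<open>j\<close>-th entry with \<open>j\<close> counted
  from 1. Beyond the end \<open>entry\<close> is \<open>-1\<close>, which gives the convention \<open>e_{n+1} = -1\<close>; only
  positions \<open>1, \<dots>, n + 1\<close> are ever used below.
\<close>
definition entry :: "int list \<Rightarrow> nat \<Rightarrow> int" where
  "entry e j = (if j \<le> length e then e ! (j - 1) else - 1)"

definition inversion_seq :: "int list \<Rightarrow> bool" where
  "inversion_seq e \<longleftrightarrow> (\<forall>j\<in>{1..length e}. 0 \<le> entry e j \<and> entry e j \<le> int j - 1)"

definition avoids_102 :: "int list \<Rightarrow> bool" where
  "avoids_102 e \<longleftrightarrow>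
     \<not> (\<exists>i j k. 1 \<le> i \<and> i < j \<and> j < k \<and> k \<le> length e \<and>
                entry e j < entry e i \<and> entry e i < entry e k)"

definition avoids_000 :: "int list \<Rightarrow> bool" where
  "avoids_000 e \<longleftrightarrow>
     \<not> (\<exists>i j k. 1 \<le> i \<and> i < j \<and> j < k \<and> k \<le> length e \<and>
                entry e i = entry e j \<and> entry e j = entry e k)"

definition avoiding_inversion_seqs :: "int list set" where
  "avoiding_inversion_seqs = {e. inversion_seq e \<and> avoids_102 e \<and> avoids_000 e}"

definition seq_dist :: "int list \<Rightarrow> nat" where
  "seq_dist e = card (set e)"

definition first_descent :: "int list \<Rightarrow> nat" where
  "first_descent e =
     (LEAST p. 1 \<le> p \<and> p \<le> length e \<and>
               (\<forall>i. 1 \<le> i \<and> i < p \<longrightarrow> entry e i \<le> entry e (i + 1)) \<and>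
               entry e p > entry e (p + 1))"

definition seq_rank :: "int list \<Rightarrow> int" where
  "seq_rank e =
     (if e = [] then 0
      else (int (first_descent e) - 1) - entry e (first_descent e))"

end

theory Submission
  imports Defs "HOL-Library.Sublist"
begin

text \<open>
  Delete all copies of the maximum \<open>M\<close> from an avoiding sequence of positive length. Conversely,
  let \<open>e\<close> be avoiding with longest weakly increasing prefix of length \<open>p\<close>, and let \<open>q\<close> be its maximum
  plus one, so that its rank is \<open>p - q\<close>. One or two copies of a new maximum \<open>M \<ge> q\<close> may be
  inserted exactly when every copy has only entries of that prefix (and copies of \<open>M\<close>) before it and
  at least \<open>M\<close> entries precede the first one: a new maximum can only play the role of the 2 in 102.
  Hence a sequence of rank \<open>s\<close> has \<open>(s + 3 - t) choose 2\<close> children of rank \<open>t > 0\<close>, and as many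
  of rank \<open>0\<close> as of rank \<open>1\<close>. With \<open>B = 1 + x B^4\<close>, the resulting recursion is solved by
  the coefficient of \<open>x^m\<close> in \<open>x^t B^(3 t + 1)\<close>.
\<close>

subsection \<open>Raney numbers\<close>

text \<open>
  \<open>raney k r\<close> is the coefficient of \<open>x^k\<close> in \<open>B^r\<close>, that is \<open>r / (4 k + r) * ((4 k + r) choose k)\<close>.
  Written as a difference of binomials, \<open>B^(r + 1) = B^r + x B^(r + 4)\<close> becomes Pascal's rule.
\<close>
definition raney :: "nat \<Rightarrow> nat \<Rightarrow> int" where
  "raney k r = int ((4 * k + r - 1) choose k)
     - (if k = 0 then 0 else 3 * int ((4 * k + r - 1) choose (k - 1)))"

lemma raney_0_left [simp]: "raney 0 r = 1"
  by (simp add: raney_def)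

lemma raney_Suc:
  "raney (Suc k) (Suc r) = raney (Suc k) r + raney k (r + 4)"
proof -
  define n where "n = 4 * k + r + 3"
  have eqs: "4 * Suc k + Suc r - 1 = Suc n" "4 * Suc k + r - 1 = n" "4 * k + (r + 4) - 1 = n"
    by (simp_all add: n_def)
  show ?thesis
    unfolding raney_def eqs by (cases k) simp_all
qed

lemma Suc_times_binomial_Suc: "Suc k * (n choose Suc k) = (n - k) * (n choose k)"
  using binomial_absorption[of k n] binomial_absorb_comp[of n k] by simp

text \<open>\<open>B^0 = 1\<close> has no terms of positive degree. In binomials: in row
  \<open>4 k + 3\<close> the entry at \<open>k + 1\<close> is exactly three times the entry at
  \<open>k\<close>.\<close>

lemma raney_Suc_0: "raney (Suc k) 0 = 0"
proof -
  have "Suc k * (4 * Suc k - 1 choose Suc k) = (4 * Suc k - 1 - k) * (4 * Suc k - 1 choose k)"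
    by (rule Suc_times_binomial_Suc)
  also have "\<dots> = Suc k * (3 * (4 * Suc k - 1 choose k))"
    by (simp add: algebra_simps)
  finally have "(4 * Suc k - 1 choose Suc k) = 3 * (4 * Suc k - 1 choose k)"
    using mult_cancel1 by blast
  then show ?thesis by (simp add: raney_def)
qed

text \<open>From \<open>B = 1 + x B^4\<close> follows \<open>1 - x B^3 = 1 / B\<close>, hence
  \<open>B^r / (1 - x B^3)^(j + 1) = B^(r + j + 1)\<close>. The sum is the coefficient of
  \<open>x^k\<close> on the left, expanded by the negative binomial series. The proof stays with
  coefficients: induction on \<open>j\<close> and, inside it, on \<open>k\<close>.\<close>

lemma raney_convolution:
  "(\<Sum>i\<le>k. int ((i + j) choose j) * raney (k - i) (r + 3 * i)) = raney k (r + j + 1)"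
proof (induction j arbitrary: k r)
  case 0
  show ?case
  proof (induction k arbitrary: r)
    case (Suc k)
    have "(\<Sum>i\<le>Suc k. raney (Suc k - i) (r + 3 * i))
        = raney (Suc k) r + (\<Sum>i\<le>k. raney (k - i) ((r + 3) + 3 * i))"
      by (subst sum.atMost_Suc_shift) (simp add: algebra_simps)
    with Suc[of "r + 3"] show ?case
      by (simp add: raney_Suc add.commute)
  qed simp
next
  case (Suc j)
  note IHj = Suc.IH
  show ?case
  proof (induction k arbitrary: r)
    case (Suc k)
    let ?f = "\<lambda>j k r i. int ((i + j) choose j) * raney (k - i) (r + 3 * i)"
    have "(\<Sum>i\<le>Suc k. ?f (Suc j) (Suc k) r i)
        = raney (Suc k) r + (\<Sum>i\<le>k. ?f (Suc j) (Suc k) r (Suc i))"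
      by (subst sum.atMost_Suc_shift) simp
    \<comment> \<open>Pascal's rule on the binomial factor splits the tail into a sum for
      \<open>j\<close> and a sum for \<open>Suc j\<close> with \<open>k\<close> lowered by
      one.\<close>
    also have "(\<Sum>i\<le>k. ?f (Suc j) (Suc k) r (Suc i))
        = (\<Sum>i\<le>k. ?f j (Suc k) r (Suc i)) + (\<Sum>i\<le>k. ?f (Suc j) k (r + 3) i)"
      by (simp add: sum.distrib[symmetric] algebra_simps)
    \<comment> \<open>The leading term is the missing \<open>i = 0\<close> term of the sum for
      \<open>j\<close>; the second sum is the inner induction hypothesis at
      \<open>r + 3\<close>.\<close>
    also have "raney (Suc k) r + ((\<Sum>i\<le>k. ?f j (Suc k) r (Suc i)) + (\<Sum>i\<le>k. ?f (Suc j) k (r + 3) i))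
        = (\<Sum>i\<le>Suc k. ?f j (Suc k) r i) + raney k (r + 3 + Suc j + 1)"
      unfolding Suc.IH by (subst sum.atMost_Suc_shift) simp
    also have "\<dots> = raney (Suc k) (r + Suc j + 1)"
      unfolding IHj using raney_Suc[of k "r + j + 1"] by (simp add: ac_simps)
    finally show ?case .
  qed simp
qed

text \<open>With \<open>N = 4 m - t\<close> and \<open>m - t = k + 1\<close>, absorption gives
  \<open>(k + 1) (N choose (k + 1)) = (3 m + 1) (N choose k)\<close>. The difference of binomials is
  therefore \<open>1 - 3 (m - t) / (3 m + 1) = (3 t + 1) / (3 m + 1)\<close> times the first
  one.\<close>

lemma raney_closed_form:
  assumes "t \<le> m"
  shows "real_of_int (raney (m - t) (3 * t + 1))
    = (3 * real t + 1) / (3 * real m + 1) * real ((4 * m - t) choose (m - t))"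
proof (cases "m - t")
  case 0
  then show ?thesis using assms by simp
next
  case (Suc k)
  then have m: "m = t + Suc k" by simp
  have N: "4 * (m - t) + (3 * t + 1) - 1 = 4 * m - t" using assms by simp
  let ?N = "4 * m - t"
  have "Suc k * (?N choose Suc k) = (?N - k) * (?N choose k)"
    by (rule Suc_times_binomial_Suc)
  also have "?N - k = 3 * m + 1" using m by simp
  finally have "real (Suc k) * real (?N choose Suc k) = (3 * real m + 1) * real (?N choose k)"
    by (metis (no_types, opaque_lifting) of_nat_1 of_nat_add of_nat_mult of_nat_numeral)
  then have "real (?N choose k) = real (Suc k) * real (?N choose Suc k) / (3 * real m + 1)"
    by (simp add: field_simps)
  then show ?thesis
    unfolding raney_def N Suc
    by (simp add: m field_simps)
qed

subsection \<open>Pattern avoidance via subsequences\<close>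

text \<open>Patterns are phrased through \<open>subseq\<close> instead of indices, so that entries
  can be inserted and deleted without shifting positions. The relation \<open>Q\<close> is kept
  general to treat 102 and 000 alike.\<close>

definition avoids3 :: "('a \<Rightarrow> 'a \<Rightarrow> 'a \<Rightarrow> bool) \<Rightarrow> 'a list \<Rightarrow> bool" where
  "avoids3 Q e \<longleftrightarrow> (\<forall>x y z. subseq [x, y, z] e \<longrightarrow> \<not> Q x y z)"

lemma subseq_Cons_Cons_iff:
  "subseq (x # xs) (a # e) \<longleftrightarrow> (a = x \<and> subseq xs e) \<or> subseq (x # xs) e"
  by (auto dest: subseq_Cons')

lemma subseq_singleton_nth: "subseq [x] e \<longleftrightarrow> (\<exists>i<length e. e ! i = x)"
  by (simp add: subseq_singleton_left in_set_conv_nth)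

lemma subseq_pair_nth:
  "subseq [x, y] e \<longleftrightarrow> (\<exists>i j. i < j \<and> j < length e \<and> e ! i = x \<and> e ! j = y)"
proof (induction e)
  case (Cons a e)
  have "(\<exists>i j. i < j \<and> j < length (a # e) \<and> (a # e) ! i = x \<and> (a # e) ! j = y)
    \<longleftrightarrow> (a = x \<and> (\<exists>j<length e. e ! j = y)) \<or> (\<exists>i j. i < j \<and> j < length e \<and> e ! i = x \<and> e ! j = y)"
    (is "?l \<longleftrightarrow> ?r")
  proof
    assume ?l
    then obtain i j where "i < j" "j < length (a # e)" "(a # e) ! i = x" "(a # e) ! j = y" by blast
    then show ?r by (cases i; cases j) auto
  next
    assume ?r
    then show ?l
    proof (elim disjE conjE exE)
      fix j assume "a = x" "j < length e" "e ! j = y"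
      then show ?l by (intro exI[of _ 0] exI[of _ "Suc j"]) simp
    next
      fix i j assume "i < j" "j < length e" "e ! i = x" "e ! j = y"
      then show ?l by (intro exI[of _ "Suc i"] exI[of _ "Suc j"]) simp
    qed
  qed
  moreover have "subseq [x, y] (a # e) \<longleftrightarrow> (a = x \<and> subseq [y] e) \<or> subseq [x, y] e"
    by (rule subseq_Cons_Cons_iff)
  ultimately show ?case
    using Cons.IH by (simp add: subseq_singleton_nth)
qed simp

lemma subseq_triple_nth:
  "subseq [x, y, z] e \<longleftrightarrow>
    (\<exists>i j k. i < j \<and> j < k \<and> k < length e \<and> e ! i = x \<and> e ! j = y \<and> e ! k = z)"
proof (induction e)
  case (Cons a e)
  have "(\<exists>i j k. i < j \<and> j < k \<and> k < length (a # e) \<and> (a # e) ! i = x \<and> (a # e) ! j = y \<and> (a # e) ! k = z)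
    \<longleftrightarrow> (a = x \<and> (\<exists>j k. j < k \<and> k < length e \<and> e ! j = y \<and> e ! k = z)) \<or>
      (\<exists>i j k. i < j \<and> j < k \<and> k < length e \<and> e ! i = x \<and> e ! j = y \<and> e ! k = z)"
    (is "?l \<longleftrightarrow> ?r")
  proof
    assume ?l
    then obtain i j k where "i < j" "j < k" "k < length (a # e)"
      "(a # e) ! i = x" "(a # e) ! j = y" "(a # e) ! k = z" by blast
    then show ?r by (cases i; cases j; cases k) auto
  next
    assume ?r
    then show ?l
    proof (elim disjE conjE exE)
      fix j k assume "a = x" "j < k" "k < length e" "e ! j = y" "e ! k = z"
      then show ?l by (intro exI[of _ 0] exI[of _ "Suc j"] exI[of _ "Suc k"]) simp
    next
      fix i j k assume "i < j" "j < k" "k < length e" "e ! i = x" "e ! j = y" "e ! k = z"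
      then show ?l by (intro exI[of _ "Suc i"] exI[of _ "Suc j"] exI[of _ "Suc k"]) simp
    qed
  qed
  moreover have "subseq [x, y, z] (a # e) \<longleftrightarrow> (a = x \<and> subseq [y, z] e) \<or> subseq [x, y, z] e"
    by (rule subseq_Cons_Cons_iff)
  ultimately show ?case
    using Cons.IH by (simp add: subseq_pair_nth)
qed simp

lemma avoids_pattern_iff:
  "(\<exists>i j k. 1 \<le> i \<and> i < j \<and> j < k \<and> k \<le> length e \<and> Q (entry e i) (entry e j) (entry e k))
    \<longleftrightarrow> \<not> avoids3 Q e" (is "?l \<longleftrightarrow> ?r")
proof
  assume ?l
  then obtain i j k where "1 \<le> i" "i < j" "j < k" "k \<le> length e"
    and Q: "Q (entry e i) (entry e j) (entry e k)" by blast
  then have "i - 1 < j - 1 \<and> j - 1 < k - 1 \<and> k - 1 < length e" by auto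
  then have "subseq [e ! (i - 1), e ! (j - 1), e ! (k - 1)] e"
    unfolding subseq_triple_nth by blast
  moreover have "Q (e ! (i - 1)) (e ! (j - 1)) (e ! (k - 1))"
    using Q \<open>i < j\<close> \<open>j < k\<close> \<open>k \<le> length e\<close> by (simp add: entry_def)
  ultimately show ?r unfolding avoids3_def by blast
next
  assume ?r
  then obtain i j k where "i < j" "j < k" "k < length e" "Q (e ! i) (e ! j) (e ! k)"
    unfolding avoids3_def subseq_triple_nth by blast
  then have "1 \<le> Suc i \<and> Suc i < Suc j \<and> Suc j < Suc k \<and> Suc k \<le> length e \<and>
    Q (entry e (Suc i)) (entry e (Suc j)) (entry e (Suc k))"
    by (simp add: entry_def)
  then show ?l by blast
qed

lemma avoids_102_iff: "avoids_102 e \<longleftrightarrow> avoids3 (\<lambda>x y z. y < x \<and> x < z) e"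
  using avoids_pattern_iff[of e "\<lambda>x y z. y < x \<and> x < z"] unfolding avoids_102_def by blast

text \<open>Taken at \<open>n = 3\<close>, this turns avoidance of 000 into a bound on
  multiplicities, which is easy to follow under insertion.\<close>

lemma subseq_replicate_iff: "subseq (replicate n v) e \<longleftrightarrow> n \<le> count_list e v"
proof (induction e arbitrary: n)
  case Nil
  then show ?case by (cases n) auto
next
  case (Cons a e)
  show ?case
  proof (cases n)
    case (Suc k)
    then show ?thesis
      using Cons[of k] Cons[of n] by (cases "a = v") (auto dest: subseq_Cons2_neq)
  qed simp
qed

lemma avoids_000_iff: "avoids_000 e \<longleftrightarrow> (\<forall>v. count_list e v \<le> 2)"
proof -
  have "avoids_000 e \<longleftrightarrow> avoids3 (\<lambda>x y z. x = y \<and> y = z) e"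
    using avoids_pattern_iff[of e "\<lambda>x y z. x = y \<and> y = z"] unfolding avoids_000_def by blast
  also have "\<dots> \<longleftrightarrow> (\<forall>v. \<not> subseq (replicate 3 v) e)"
    by (auto simp: avoids3_def numeral_3_eq_3)
  finally show ?thesis
    unfolding subseq_replicate_iff by (simp add: not_le less_Suc_eq_le numeral_3_eq_3 numeral_2_eq_2)
qed

section \<open>Inversion sequences through entrywise bounds\<close>

text \<open>The offset \<open>n\<close> counts the entries already passed, so the condition splits
  over concatenation; inversion sequences are the case \<open>n = 0\<close>.\<close>

primrec bounded_from :: "nat \<Rightarrow> int list \<Rightarrow> bool" where
  "bounded_from n [] \<longleftrightarrow> True"
| "bounded_from n (x # e) \<longleftrightarrow> 0 \<le> x \<and> x \<le> int n \<and> bounded_from (Suc n) e"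

lemma bounded_from_append:
  "bounded_from n (e @ e') \<longleftrightarrow> bounded_from n e \<and> bounded_from (n + length e) e'"
  by (induction e arbitrary: n) auto

text \<open>The upper bounds grow along the list, so respecting the first of them settles all. This
  handles the entries pushed to the right by an inserted maximum.\<close>

lemma bounded_from_iff_nonneg:
  "\<forall>x\<in>set e. x \<le> int n \<Longrightarrow> bounded_from n e \<longleftrightarrow> (\<forall>x\<in>set e. 0 \<le> x)"
proof (induction e arbitrary: n)
  case (Cons a e)
  then have "\<forall>x\<in>set e. x \<le> int (Suc n)" by auto
  with Cons.IH[of "Suc n"] Cons.prems show ?case by simp
qed simp

lemma bounded_from_nonneg: "bounded_from n e \<Longrightarrow> x \<in> set e \<Longrightarrow> 0 \<le> x"
  by (induction e arbitrary: n) auto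

lemma bounded_from_iff_nth:
  "bounded_from n e \<longleftrightarrow> (\<forall>i<length e. 0 \<le> e ! i \<and> e ! i \<le> int (n + i))"
  by (induction e arbitrary: n) (auto simp: All_less_Suc2)

lemma inversion_seq_iff: "inversion_seq e \<longleftrightarrow> bounded_from 0 e"
proof -
  have "inversion_seq e \<longleftrightarrow> (\<forall>i<length e. 0 \<le> entry e (Suc i) \<and> entry e (Suc i) \<le> int (Suc i) - 1)"
    unfolding inversion_seq_def image_Suc_lessThan[symmetric]
    by (simp only: ball_simps) (simp only: Ball_def lessThan_iff)
  also have "\<dots> \<longleftrightarrow> bounded_from 0 e"
    unfolding bounded_from_iff_nth by (intro all_cong) (simp add: entry_def)
  finally show ?thesis .
qed

lemma mem_avoiding_iff:
  "e \<in> avoiding_inversion_seqs \<longleftrightarrow>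
    bounded_from 0 e \<and> avoids3 (\<lambda>x y z. y < x \<and> x < z) e \<and> (\<forall>v. count_list e v \<le> 2)"
  by (simp add: avoiding_inversion_seqs_def inversion_seq_iff avoids_102_iff avoids_000_iff)

section \<open>Membership after insertion of a maximum\<close>

lemma sorted_iff_subseq: "sorted e \<longleftrightarrow> (\<forall>x y. subseq [x, y] e \<longrightarrow> x \<le> y)"
  by (auto simp: sorted_iff_nth_mono_less subseq_pair_nth)

text \<open>An inserted \<open>M\<close> can only be the largest letter of a 102, so new occurrences
  correspond to decreasing pairs of smaller entries before it. The weak bound and the filter admit
  copies of \<open>M\<close> already present, so that the lemma can be applied twice.\<close>

lemma avoids_102_insert_max:
  fixes M :: "'a :: linorder"
  assumes "\<forall>x\<in>set (X @ Z). x \<le> M"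
  shows "avoids3 (\<lambda>x y z. y < x \<and> x < z) (X @ M # Z) \<longleftrightarrow>
    avoids3 (\<lambda>x y z. y < x \<and> x < z) (X @ Z) \<and> sorted (filter (\<lambda>x. x \<noteq> M) X)"
    (is "?l \<longleftrightarrow> ?r1 \<and> ?r2")
proof (intro iffI conjI)
  assume l: ?l
  show ?r1
  proof -
    have "subseq (X @ Z) (X @ M # Z)"
      unfolding subseq_append' by (intro list_emb_Cons) simp
    then show ?thesis
      using l subseq_order.trans[of _ "X @ Z" "X @ M # Z"] unfolding avoids3_def by blast
  qed
  show ?r2
    unfolding sorted_iff_subseq
  proof (intro allI impI)
    fix x y assume s: "subseq [x, y] (filter (\<lambda>x. x \<noteq> M) X)"
    then have "subseq [x, y] X" by (rule subseq_order.trans) simp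
    then have "subseq ([x, y] @ [M]) (X @ M # Z)" by (intro list_emb_append_mono) auto
    then have "\<not> (y < x \<and> x < M)" using l by (simp add: avoids3_def)
    moreover have "x \<in> set (filter (\<lambda>x. x \<noteq> M) X)"
      using list_emb_set[OF s, of x] by auto
    then have "x < M" using assms by (auto simp: less_le)
    ultimately show "x \<le> y" by auto
  qed
next
  assume r: "?r1 \<and> ?r2"
  show ?l
    unfolding avoids3_def
  proof (intro allI impI notI)
    fix x y z assume s: "subseq [x, y, z] (X @ M # Z)" and Q: "y < x \<and> x < z"
    have "z \<in> set (X @ M # Z)" using list_emb_set[OF s, of z] by auto
    then have zM: "z \<le> M" using assms by auto
    show False
    proof (cases "subseq [x, y, z] (X @ Z)")
      case True
      then show False using r Q by (auto simp: avoids3_def)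
    next
      case False
      obtain us vs where uv: "[x, y, z] = us @ vs" "subseq us X" "subseq vs (M # Z)"
        using s by (rule subseq_appendE)
      \<comment> \<open>The part of the triple embedded in \<open>M # Z\<close> must start with the
        inserted \<open>M\<close>; otherwise the triple would already lie in
        \<open>X @ Z\<close>.\<close>
      then have "\<not> subseq vs Z" using False list_emb_append_mono[of "(=)" us X vs Z] by auto
      then obtain vs' where vs: "vs = M # vs'"
        using uv(3) by (cases vs) (auto split: if_splits)
      \<comment> \<open>Since \<open>y < x < z \<le> M\<close>, only \<open>z\<close> can be the
        inserted letter, so the decreasing pair lies in \<open>X\<close>.\<close>
      have "M \<noteq> x" "M \<noteq> y" using Q zM by auto
      then have "us = [x, y]" using uv(1) vs by (auto simp: Cons_eq_append_conv)
      then have "subseq [x, y] (filter (\<lambda>x. x \<noteq> M) X)"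
        using uv(2) \<open>M \<noteq> x\<close> \<open>M \<noteq> y\<close> subseq_filter[of us X "\<lambda>x. x \<noteq> M"] by simp
      then have "x \<le> y" using r unfolding sorted_iff_subseq by blast
      then show False using Q by (simp add: leD)
    qed
  qed
qed

lemma mem_avoiding_insert_max:
  assumes "\<forall>x\<in>set (X @ Z). x < M"
  shows "X @ M # Z \<in> avoiding_inversion_seqs \<longleftrightarrow>
    X @ Z \<in> avoiding_inversion_seqs \<and> sorted X \<and> 0 \<le> M \<and> M \<le> int (length X)"
proof -
  have "avoids3 (\<lambda>x y z. y < x \<and> x < z) (X @ M # Z) \<longleftrightarrow>
      avoids3 (\<lambda>x y z. y < x \<and> x < z) (X @ Z) \<and> sorted (filter (\<lambda>x. x \<noteq> M) X)"
    using assms by (intro avoids_102_insert_max) (simp add: less_imp_le)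
  moreover have "filter (\<lambda>x. x \<noteq> M) X = X"
    using assms by (auto simp: filter_id_conv)
  moreover have "(\<forall>v. count_list (X @ M # Z) v \<le> 2) \<longleftrightarrow> (\<forall>v. count_list (X @ Z) v \<le> 2)"
  proof -
    have "M \<notin> set (X @ Z)" using assms by blast
    then have "count_list (X @ Z) M = 0" by (rule count_notin)
    then have "count_list (X @ M # Z) v \<le> 2 \<longleftrightarrow> count_list (X @ Z) v \<le> 2" for v
      by (cases "v = M") simp_all
    then show ?thesis by simp
  qed
  moreover have "bounded_from 0 (X @ M # Z) \<longleftrightarrow> bounded_from 0 (X @ Z) \<and> 0 \<le> M \<and> M \<le> int (length X)"
  proof (cases "M \<le> int (length X)")
    case True
    \<comment> \<open>Entries after the new maximum are below \<open>M\<close>, hence within their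
      bounds both before and after the shift by one.\<close>
    have "x \<le> int (length X) \<and> x \<le> int (Suc (length X))" if "x \<in> set Z" for x
    proof -
      have "x < M" using assms that by simp
      with True show ?thesis by simp
    qed
    then show ?thesis
      using True by (auto simp: bounded_from_append bounded_from_iff_nonneg)
  qed (simp add: bounded_from_append)
  ultimately show ?thesis unfolding mem_avoiding_iff by auto
qed

lemma mem_avoiding_insert_max_twice:
  assumes "\<forall>x\<in>set (X @ Y @ Z). x < M"
  shows "X @ M # Y @ M # Z \<in> avoiding_inversion_seqs \<longleftrightarrow>
    X @ Y @ Z \<in> avoiding_inversion_seqs \<and> sorted (X @ Y) \<and> 0 \<le> M \<and> M \<le> int (length X)"
proof -
  let ?Q = "\<lambda>x y z :: int. y < x \<and> x < z"
  have f: "filter (\<lambda>x. x \<noteq> M) X = X" "filter (\<lambda>x. x \<noteq> M) Y = Y"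
    using assms by (auto simp: filter_id_conv)
  \<comment> \<open>The second copy is removed first: the filter erases the first copy from its
    prefix and leaves \<open>X @ Y\<close>. Removing the other copy then asks for
    \<open>sorted X\<close>, which \<open>sorted (X @ Y)\<close> contains.\<close>
  have "avoids3 ?Q ((X @ M # Y) @ M # Z) \<longleftrightarrow> avoids3 ?Q (X @ M # Y @ Z) \<and> sorted (X @ Y)"
    using assms f by (subst avoids_102_insert_max) (auto simp: less_imp_le)
  also have "\<dots> \<longleftrightarrow> avoids3 ?Q (X @ Y @ Z) \<and> sorted (X @ Y)"
    using assms f by (subst avoids_102_insert_max) (auto simp: less_imp_le sorted_append)
  finally have "avoids3 ?Q (X @ M # Y @ M # Z) \<longleftrightarrow> avoids3 ?Q (X @ Y @ Z) \<and> sorted (X @ Y)"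
    by simp
  moreover have "(\<forall>v. count_list (X @ M # Y @ M # Z) v \<le> 2) \<longleftrightarrow> (\<forall>v. count_list (X @ Y @ Z) v \<le> 2)"
  proof -
    have "M \<notin> set (X @ Y @ Z)" using assms by blast
    then have "count_list (X @ Y @ Z) M = 0" by (rule count_notin)
    then have "count_list (X @ M # Y @ M # Z) v \<le> 2 \<longleftrightarrow> count_list (X @ Y @ Z) v \<le> 2" for v
      by (cases "v = M") simp_all
    then show ?thesis by simp
  qed
  moreover have "bounded_from 0 (X @ M # Y @ M # Z) \<longleftrightarrow>
    bounded_from 0 (X @ Y @ Z) \<and> 0 \<le> M \<and> M \<le> int (length X)"
  proof (cases "M \<le> int (length X)")
    case True
    have le: "x \<le> int (length X)" if "x \<in> set (Y @ Z)" for x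
    proof -
      have "x < M" using assms that by auto
      with True show ?thesis by simp
    qed
    moreover have "x \<le> int (Suc (length X))" if "x \<in> set (Y @ M # Z)" for x
      using True le[of x] that by auto
    ultimately show ?thesis
      using True bounded_from_append[of 0 X "M # Y @ M # Z"] bounded_from_append[of 0 X "Y @ Z"]
      by (auto simp: bounded_from_iff_nonneg)
  qed (simp add: bounded_from_append)
  ultimately show ?thesis unfolding mem_avoiding_iff by auto
qed

subsection \<open>Rank and the longest weakly increasing prefix\<close>

text \<open>A recursive form of \<open>first_descent\<close> that also has a sensible value on the
  empty list.\<close>

fun ascent_length :: "'a :: linorder list \<Rightarrow> nat" where
  "ascent_length [] = 0"
| "ascent_length [x] = 1"
| "ascent_length (x # y # e) = (if x \<le> y then Suc (ascent_length (y # e)) else 1)"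

lemma ascent_length_le: "ascent_length e \<le> length e"
  by (induction e rule: ascent_length.induct) auto

lemma ascent_length_pos: "e \<noteq> [] \<Longrightarrow> 0 < ascent_length e"
  by (induction e rule: ascent_length.induct) auto

text \<open>Converts the sortedness required before an inserted maximum into an upper bound on its
  position.\<close>

lemma sorted_take_iff: "b \<le> length e \<Longrightarrow> sorted (take b e) \<longleftrightarrow> b \<le> ascent_length e"
proof (induction e arbitrary: b rule: ascent_length.induct)
  case (2 x)
  then show ?case by (cases b) auto
next
  case (3 x y e)
  show ?case
  proof (cases b)
    case (Suc b')
    show ?thesis
    proof (cases "x \<le> y")
      case True
      have "sorted (x # take b' (y # e)) \<longleftrightarrow> sorted (take b' (y # e))"
        using True by (cases b') (auto simp: take_Cons')
      then show ?thesis using 3 True Suc by auto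
    next
      case False
      then show ?thesis using Suc by (cases b') auto
    qed
  qed simp
qed simp

text \<open>Applied with \<open>X\<close> ending in a new maximum, after which the next entry is
  smaller, so the weakly increasing prefix stops there.\<close>

lemma ascent_length_append:
  "sorted X \<Longrightarrow> X \<noteq> [] \<Longrightarrow> Y = [] \<or> hd Y < last X \<Longrightarrow> ascent_length (X @ Y) = length X"
proof (induction X)
  case (Cons x X)
  show ?case
  proof (cases X)
    case Nil
    then show ?thesis using Cons.prems by (cases Y) auto
  next
    case (Cons z X')
    then show ?thesis using Cons.IH Cons.prems by auto
  qed
qed simp

lemma nth_descent_at_ascent_length:
  "ascent_length e < length e \<Longrightarrow> e ! ascent_length e < e ! (ascent_length e - 1)"
proof (induction e rule: ascent_length.induct)
  case (3 x y e)
  then show ?case using ascent_length_pos[of "y # e"] by (auto simp: nth_Cons split: nat.splits)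
qed auto

lemma first_descent_eq:
  assumes "e \<noteq> []" "\<forall>x\<in>set e. 0 \<le> x"
  shows "first_descent e = ascent_length e"
  unfolding first_descent_def
proof (rule Least_equality)
  let ?p = "ascent_length e"
  have p: "0 < ?p" "?p \<le> length e" using assms ascent_length_pos ascent_length_le by auto
  have s: "sorted (take ?p e)" using sorted_take_iff p by blast
  have asc: "entry e i \<le> entry e (i + 1)" if "1 \<le> i" "i < ?p" for i
    using sorted_nth_mono[OF s, of "i - 1" i] that p by (simp add: entry_def)
  have "entry e (?p + 1) < entry e ?p"
  proof (cases "?p = length e")
    case True
    \<comment> \<open>For a weakly increasing list the descent is the one to the conventional entry
      \<open>-1\<close> behind the end.\<close>
    have "0 \<le> e ! (?p - 1)" using assms(2) p by simp
    then show ?thesis using True by (simp add: entry_def)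
  next
    case False
    then show ?thesis using nth_descent_at_ascent_length[of e] p by (simp add: entry_def)
  qed
  then show "1 \<le> ?p \<and> ?p \<le> length e \<and>
      (\<forall>i. 1 \<le> i \<and> i < ?p \<longrightarrow> entry e i \<le> entry e (i + 1)) \<and> entry e ?p > entry e (?p + 1)"
    using p asc by auto
  show "?p \<le> q" if "1 \<le> q \<and> q \<le> length e \<and>
      (\<forall>i. 1 \<le> i \<and> i < q \<longrightarrow> entry e i \<le> entry e (i + 1)) \<and> entry e q > entry e (q + 1)" for q
    using asc[of q] that by (meson leD not_le_imp_less)
qed

text \<open>The empty list gets \<open>0\<close>, so that \<open>seq_rank_eq\<close> needs no exception for it.\<close>
definition max_succ :: "int list \<Rightarrow> nat" where
  "max_succ e = Max (insert 0 ((\<lambda>x. nat (x + 1)) ` set e))"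

lemma max_succ_le_iff: "max_succ e \<le> n \<longleftrightarrow> (\<forall>x\<in>set e. x < int n)"
  unfolding max_succ_def by (subst Max_le_iff) auto

lemma max_succ_eqI: "int n \<in> set e \<Longrightarrow> \<forall>x\<in>set e. x \<le> int n \<Longrightarrow> max_succ e = Suc n"
  by (metis linorder_not_less not_less_eq_eq order_antisym max_succ_le_iff of_nat_less_iff
      verit_comp_simplify1(3) zle_add1_eq_le of_nat_Suc add.commute)

lemma avoiding_nonneg: "e \<in> avoiding_inversion_seqs \<Longrightarrow> x \<in> set e \<Longrightarrow> 0 \<le> x"
  using bounded_from_nonneg mem_avoiding_iff by blast

text \<open>A larger entry cannot lie in the sorted prefix, so it comes after the first descent and
  completes that descent to a 102. Hence the prefix ends in the maximum of the sequence.\<close>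

lemma avoiding_le_last_ascent:
  assumes "e \<in> avoiding_inversion_seqs" "x \<in> set e"
  shows "x \<le> e ! (ascent_length e - 1)"
proof (rule ccontr)
  assume less: "\<not> x \<le> e ! (ascent_length e - 1)"
  let ?p = "ascent_length e"
  obtain k where k: "k < length e" "e ! k = x" using assms(2) by (auto simp: in_set_conv_nth)
  have p: "0 < ?p" "?p \<le> length e" using assms(2) ascent_length_pos[of e] ascent_length_le[of e] by (cases "e = []"; simp)+
  have s: "sorted (take ?p e)" using sorted_take_iff p by blast
  have "?p \<le> k"
    using sorted_nth_mono[OF s, of k "?p - 1"] p k less by (cases "k < ?p") auto
  then have d: "e ! ?p < e ! (?p - 1)"
    using nth_descent_at_ascent_length[of e] k by simp
  then have "k \<noteq> ?p" using k less by auto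
  then have "?p - 1 < ?p \<and> ?p < k \<and> k < length e" using \<open>?p \<le> k\<close> p k by auto
  then have "subseq [e ! (?p - 1), e ! ?p, x] e"
    unfolding subseq_triple_nth using k by blast
  moreover have "e ! (?p - 1) < x" using less by simp
  ultimately show False using assms(1) d unfolding mem_avoiding_iff avoids3_def by blast
qed

text \<open>The prefix, of length \<open>p\<close>, ends in the maximum, so
  \<open>(p - 1) - e_p\<close> is \<open>p\<close> minus the maximum plus one.\<close>

lemma seq_rank_eq:
  assumes "e \<in> avoiding_inversion_seqs"
  shows "seq_rank e = int (ascent_length e) - int (max_succ e)"
proof (cases "e = []")
  case True
  then show ?thesis by (simp add: seq_rank_def max_succ_def)
next
  case False
  let ?p = "ascent_length e"
  have p: "0 < ?p" "?p \<le> length e" using False ascent_length_pos ascent_length_le by auto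
  have mem: "e ! (?p - 1) \<in> set e" using p by simp
  then obtain n where n: "e ! (?p - 1) = int n"
    using avoiding_nonneg[OF assms] nonneg_int_cases by blast
  have "max_succ e = Suc n"
    using avoiding_le_last_ascent[OF assms] n mem by (intro max_succ_eqI) auto
  moreover have "first_descent e = ?p"
    using avoiding_nonneg[OF assms] False by (intro first_descent_eq) auto
  ultimately show ?thesis
    using False n p by (simp add: seq_rank_def entry_def)
qed

text \<open>The maximum sits at the end of the prefix, where the inversion bound is its length minus
  one. Ranks are therefore natural numbers.\<close>

lemma max_succ_le_ascent_length:
  assumes "e \<in> avoiding_inversion_seqs"
  shows "max_succ e \<le> ascent_length e"
  unfolding max_succ_le_iff
proof
  fix x assume x: "x \<in> set e"
  let ?p = "ascent_length e"
  have p: "0 < ?p" "?p \<le> length e" using x ascent_length_pos[of e] ascent_length_le[of e] by (cases "e = []"; simp)+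
  then have "?p - 1 < length e" by simp
  then have "e ! (?p - 1) \<le> int (?p - 1)"
    using assms unfolding mem_avoiding_iff bounded_from_iff_nth by auto
  with avoiding_le_last_ascent[OF assms x] p show "x < int ?p" by simp
qed

subsection \<open>Inserting a new maximum\<close>

definition insert_once :: "int list \<Rightarrow> nat \<times> nat \<Rightarrow> int list" where
  "insert_once e = (\<lambda>(a, n). take a e @ int n # drop a e)"

text \<open>Both \<open>a\<close> and \<open>b\<close> count entries of the original
  \<open>e\<close>, so \<open>a = b\<close> means that the two copies are adjacent.\<close>

definition insert_twice :: "int list \<Rightarrow> nat \<times> nat \<times> nat \<Rightarrow> int list" where
  "insert_twice e = (\<lambda>(a, b, n). take a e @ int n # drop a (take b e) @ int n # drop b e)"

definition parent :: "int list \<Rightarrow> int list" where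
  "parent e = filter (\<lambda>x. x \<noteq> Max (set e)) e"

lemma parent_insert_once:
  assumes "\<forall>x\<in>set (X @ Z). x < M"
  shows "parent (X @ M # Z) = X @ Z" "Max (set (X @ M # Z)) = M"
proof -
  show M: "Max (set (X @ M # Z)) = M" using assms by (intro Max_eqI) (auto simp: less_imp_le)
  have "filter (\<lambda>x. x \<noteq> M) X = X" "filter (\<lambda>x. x \<noteq> M) Z = Z"
    using assms by (auto simp: filter_id_conv)
  then show "parent (X @ M # Z) = X @ Z" unfolding parent_def M by simp
qed

lemma parent_insert_twice:
  assumes "\<forall>x\<in>set (X @ Y @ Z). x < M"
  shows "parent (X @ M # Y @ M # Z) = X @ Y @ Z" "Max (set (X @ M # Y @ M # Z)) = M"
proof -
  show M: "Max (set (X @ M # Y @ M # Z)) = M" using assms by (intro Max_eqI) (auto simp: less_imp_le)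
  have "filter (\<lambda>x. x \<noteq> M) X = X" "filter (\<lambda>x. x \<noteq> M) Y = Y" "filter (\<lambda>x. x \<noteq> M) Z = Z"
    using assms by (auto simp: filter_id_conv)
  then show "parent (X @ M # Y @ M # Z) = X @ Y @ Z" unfolding parent_def M by simp
qed

text \<open>The three inequalities say in turn that \<open>n\<close> exceeds every entry, that the
  inversion bound holds at the new entry, and that the entries before it are sorted.\<close>

definition once_sites :: "int list \<Rightarrow> (nat \<times> nat) set" where
  "once_sites e = {(a, n). max_succ e \<le> n \<and> n \<le> a \<and> a \<le> ascent_length e}"

definition twice_sites :: "int list \<Rightarrow> (nat \<times> nat \<times> nat) set" where
  "twice_sites e = {(a, b, n). max_succ e \<le> n \<and> n \<le> a \<and> a \<le> b \<and> b \<le> ascent_length e}"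

lemma take_append_drop_take: "a \<le> b \<Longrightarrow> take a e @ drop a (take b e) = take b e"
  by (metis append_take_drop_id min.absorb1 take_take)

lemma take_drop_take_drop: "a \<le> b \<Longrightarrow> take a e @ drop a (take b e) @ drop b e = e"
  by (metis append.assoc append_take_drop_id take_append_drop_take)

text \<open>The new maximum ends the prefix at length \<open>a + 1\<close>, and
  \<open>max_succ\<close> becomes \<open>n + 1\<close>; the difference is the new rank.\<close>

lemma insert_once_child:
  assumes "e \<in> avoiding_inversion_seqs" "(a, n) \<in> once_sites e"
  shows "insert_once e (a, n) \<in> avoiding_inversion_seqs" "parent (insert_once e (a, n)) = e"
    "Max (set (insert_once e (a, n))) = int n"
    "seq_rank (insert_once e (a, n)) = int a - int n"
proof -
  let ?X = "take a e" and ?Z = "drop a e"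
  have s: "max_succ e \<le> n" "n \<le> a" "a \<le> ascent_length e" using assms(2) by (auto simp: once_sites_def)
  have a: "a \<le> length e" using s ascent_length_le[of e] by simp
  have lt: "\<forall>x\<in>set (?X @ ?Z). x < int n" using s by (simp add: max_succ_le_iff)
  have eq: "insert_once e (a, n) = ?X @ int n # ?Z" by (simp add: insert_once_def)
  have sX: "sorted ?X" using s a sorted_take_iff by blast
  show av: "insert_once e (a, n) \<in> avoiding_inversion_seqs"
    unfolding eq mem_avoiding_insert_max[OF lt] using assms(1) s a sX by simp
  show "parent (insert_once e (a, n)) = e" "Max (set (insert_once e (a, n))) = int n"
    unfolding eq using parent_insert_once[OF lt] by simp_all
  have "sorted (?X @ [int n])" using sX lt by (auto simp: sorted_append intro: less_imp_le dest!: in_set_takeD)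
  then have "ascent_length ((?X @ [int n]) @ ?Z) = length (?X @ [int n])"
  proof (rule ascent_length_append)
    show "?Z = [] \<or> hd ?Z < last (?X @ [int n])"
      using lt hd_in_set[of ?Z] in_set_dropD[of "hd ?Z" a e] by (cases "?Z = []") auto
  qed simp
  then have "ascent_length (insert_once e (a, n)) = Suc a" using a eq by simp
  moreover have "max_succ (insert_once e (a, n)) = Suc n"
    unfolding eq using lt by (intro max_succ_eqI) (auto intro: less_imp_le dest!: in_set_takeD in_set_dropD)
  ultimately show "seq_rank (insert_once e (a, n)) = int a - int n"
    using seq_rank_eq[OF av] by simp
qed

text \<open>Adjacent copies both belong to the weakly increasing prefix, which then has length
  \<open>a + 2\<close>. Otherwise a smaller entry follows the first copy and the length is
  \<open>a + 1\<close>.\<close>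

lemma insert_twice_child:
  assumes "e \<in> avoiding_inversion_seqs" "(a, b, n) \<in> twice_sites e"
  shows "insert_twice e (a, b, n) \<in> avoiding_inversion_seqs" "parent (insert_twice e (a, b, n)) = e"
    "Max (set (insert_twice e (a, b, n))) = int n"
    "seq_rank (insert_twice e (a, b, n)) = (if a = b then int a + 1 else int a) - int n"
proof -
  let ?X = "take a e" and ?Y = "drop a (take b e)" and ?Z = "drop b e"
  have s: "max_succ e \<le> n" "n \<le> a" "a \<le> b" "b \<le> ascent_length e"
    using assms(2) by (auto simp: twice_sites_def)
  have b: "b \<le> length e" using s ascent_length_le[of e] by simp
  have XYZ: "?X @ ?Y @ ?Z = e" "?X @ ?Y = take b e"
    using s take_drop_take_drop take_append_drop_take by blast+
  have "\<forall>x\<in>set e. x < int n" using s by (simp add: max_succ_le_iff)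
  then have lt: "\<forall>x\<in>set (?X @ ?Y @ ?Z). x < int n" unfolding XYZ .
  have eq: "insert_twice e (a, b, n) = ?X @ int n # ?Y @ int n # ?Z"
    by (simp add: insert_twice_def)
  have sX: "sorted (?X @ ?Y)" using s b sorted_take_iff XYZ by metis
  show av: "insert_twice e (a, b, n) \<in> avoiding_inversion_seqs"
    unfolding eq mem_avoiding_insert_max_twice[OF lt] using assms(1) s b sX XYZ by simp
  show "parent (insert_twice e (a, b, n)) = e" "Max (set (insert_twice e (a, b, n))) = int n"
    unfolding eq using parent_insert_twice[OF lt] XYZ by simp_all
  have "sorted (?X @ [int n])" "sorted (?X @ [int n, int n])"
    using sX lt by (auto simp: sorted_append less_imp_le)
  have "ascent_length (insert_twice e (a, b, n)) = (if a = b then Suc (Suc a) else Suc a)"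
  proof (cases "a = b")
    case True
    have "ascent_length ((?X @ [int n, int n]) @ ?Z) = length (?X @ [int n, int n])"
      using lt hd_in_set[of ?Z] \<open>sorted (?X @ [int n, int n])\<close>
      by (intro ascent_length_append) auto
    then show ?thesis using True b eq by simp
  next
    case False
    then have "?Y \<noteq> []" using s b by simp
    then have "hd ?Y \<in> set (?X @ ?Y @ ?Z)" using hd_in_set[of ?Y] by simp
    then have "hd ?Y < int n" using lt by blast
    then have "hd (?Y @ int n # ?Z) < last (?X @ [int n])"
      using \<open>?Y \<noteq> []\<close> by (simp add: hd_append)
    then have "ascent_length ((?X @ [int n]) @ (?Y @ int n # ?Z)) = length (?X @ [int n])"
      using \<open>sorted (?X @ [int n])\<close> by (intro ascent_length_append) auto
    then show ?thesis using False b s eq by simp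
  qed
  moreover have "max_succ (insert_twice e (a, b, n)) = Suc n"
    unfolding eq using lt by (intro max_succ_eqI) (auto simp: less_imp_le)
  ultimately show "seq_rank (insert_twice e (a, b, n)) = (if a = b then int a + 1 else int a) - int n"
    using seq_rank_eq[OF av] by auto
qed

text \<open>Splitting at the first and, if present, second copy of the maximum recovers the site;
  avoidance of 000 excludes a third copy.\<close>

lemma avoiding_cases:
  assumes "e' \<in> avoiding_inversion_seqs" "e' \<noteq> []"
  shows "parent e' \<in> avoiding_inversion_seqs \<and>
    (e' \<in> insert_once (parent e') ` once_sites (parent e') \<or>
     e' \<in> insert_twice (parent e') ` twice_sites (parent e'))"
proof -
  let ?M = "Max (set e')"
  have "?M \<in> set e'" using assms(2) by simp
  then obtain X W where XW: "e' = X @ ?M # W" "?M \<notin> set X" using split_list_first by metis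
  obtain n where n: "?M = int n"
    using avoiding_nonneg[OF assms(1)] \<open>?M \<in> set e'\<close> nonneg_int_cases by blast
  have le: "x \<le> int n" if "x \<in> set e'" for x using that n by (metis List.finite_set Max_ge)
  show ?thesis
  proof (cases "?M \<in> set W")
    case False
    have e': "e' = X @ int n # W" using XW n by simp
    have lt: "\<forall>x\<in>set (X @ W). x < int n"
      using le False XW n e' by (auto simp: less_le)
    have p: "parent e' = X @ W" unfolding e' using parent_insert_once[OF lt] by simp
    have c: "X @ W \<in> avoiding_inversion_seqs" "sorted X" "n \<le> length X"
      using assms(1) mem_avoiding_insert_max[OF lt] unfolding e' by auto
    have "length X \<le> ascent_length (X @ W)"
      using c(2) sorted_take_iff[of "length X" "X @ W"] by simp
    moreover have "max_succ (X @ W) \<le> n" using lt by (simp add: max_succ_le_iff)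
    ultimately have "(length X, n) \<in> once_sites (X @ W)" using c by (simp add: once_sites_def)
    moreover have "e' = insert_once (X @ W) (length X, n)" by (simp add: insert_once_def e')
    ultimately show ?thesis using p c by auto
  next
    case True
    then obtain Y Z where YZ: "W = Y @ ?M # Z" "?M \<notin> set Y" using split_list_first by metis
    have e': "e' = X @ int n # Y @ int n # Z" using XW YZ n by simp
    have "count_list e' (int n) \<le> 2" using assms(1) by (simp add: mem_avoiding_iff)
    then have "int n \<notin> set Z" unfolding e' by (auto simp: count_list_0_iff)
    then have lt: "\<forall>x\<in>set (X @ Y @ Z). x < int n"
      using le XW YZ n e' by (auto simp: less_le)
    have p: "parent e' = X @ Y @ Z" unfolding e' using parent_insert_twice[OF lt] by simp
    have c: "X @ Y @ Z \<in> avoiding_inversion_seqs" "sorted (X @ Y)" "n \<le> length X"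
      using assms(1) mem_avoiding_insert_max_twice[OF lt] unfolding e' by auto
    have "length (X @ Y) \<le> ascent_length (X @ Y @ Z)"
      using c(2) sorted_take_iff[of "length (X @ Y)" "X @ Y @ Z"] by simp
    moreover have "max_succ (X @ Y @ Z) \<le> n" using lt by (simp add: max_succ_le_iff)
    ultimately have "(length X, length (X @ Y), n) \<in> twice_sites (X @ Y @ Z)"
      using c by (simp add: twice_sites_def)
    moreover have "e' = insert_twice (X @ Y @ Z) (length X, length (X @ Y), n)"
      by (simp add: insert_twice_def e')
    ultimately show ?thesis using p c by auto
  qed
qed

subsection \<open>Counting\<close>

lemma seq_dist_parent:
  assumes "e \<noteq> []"
  shows "seq_dist e = Suc (seq_dist (parent e))"
proof -
  have "set (parent e) = set e - {Max (set e)}" by (auto simp: parent_def)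
  then show ?thesis
    using assms card.remove[of "set e" "Max (set e)"] by (simp add: seq_dist_def)
qed

text \<open>The empty list is excluded because \<open>parent\<close> maps it to itself.\<close>

definition children :: "nat \<Rightarrow> int list \<Rightarrow> int list set" where
  "children t e = {e' \<in> avoiding_inversion_seqs. e' \<noteq> [] \<and> parent e' = e \<and> seq_rank e' = int t}"

lemma takeWhile_neq_append: "x \<notin> set X \<Longrightarrow> takeWhile (\<lambda>y. y \<noteq> x) (X @ x # Y) = X"
  by (induction X) auto

text \<open>The site can be read off the child: \<open>n\<close> is its maximum and \<open>a\<close>
  the number of entries before that maximum.\<close>

lemma inj_on_insert_once:
  assumes "e \<in> avoiding_inversion_seqs"
  shows "inj_on (insert_once e) (once_sites e)"
proof -
  define pos where "pos e' = length (takeWhile (\<lambda>y. y \<noteq> Max (set e')) e')" for e' :: "int list"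
  have "(pos (insert_once e (a, n)), nat (Max (set (insert_once e (a, n))))) = (a, n)"
    if s: "(a, n) \<in> once_sites e" for a n
  proof -
    have M: "Max (set (insert_once e (a, n))) = int n" using insert_once_child[OF assms s] by simp
    have "\<forall>x\<in>set e. x < int n" using s by (auto simp: once_sites_def simp flip: max_succ_le_iff)
    then have "int n \<notin> set (take a e)" using in_set_takeD by fastforce
    moreover have "a \<le> length e" using s ascent_length_le[of e] by (auto simp: once_sites_def)
    ultimately have "pos (insert_once e (a, n)) = a"
      unfolding pos_def M by (simp add: insert_once_def takeWhile_neq_append)
    then show ?thesis using M by simp
  qed
  then show ?thesis
    by (intro inj_on_inverseI[where g = "\<lambda>e'. (pos e', nat (Max (set e')))"]) auto
qed

lemma inj_on_insert_twice:
  assumes "e \<in> avoiding_inversion_seqs"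
  shows "inj_on (insert_twice e) (twice_sites e)"
proof -
  define pos where "pos n e' = length (takeWhile (\<lambda>y. y \<noteq> n) e')" for n and e' :: "int list"
  \<comment> \<open>After dropping everything up to the first copy, the entries before the second
    copy number \<open>b - a\<close>.\<close>
  define g where "g e' = (let n = Max (set e'); a = pos n e'
    in (a, a + pos n (drop (Suc a) e'), nat n))" for e'
  have "g (insert_twice e (a, b, n)) = (a, b, n)" if s: "(a, b, n) \<in> twice_sites e" for a b n
  proof -
    have M: "Max (set (insert_twice e (a, b, n))) = int n" using insert_twice_child[OF assms s] by simp
    have "\<forall>x\<in>set e. x < int n" using s by (auto simp: twice_sites_def simp flip: max_succ_le_iff)
    then have n: "int n \<notin> set (take a e)" "int n \<notin> set (drop a (take b e))"
      by (fastforce dest: in_set_takeD in_set_dropD)+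
    have ab: "a \<le> b" "b \<le> length e" using s ascent_length_le[of e] by (auto simp: twice_sites_def)
    have "pos (int n) (insert_twice e (a, b, n)) = a"
      unfolding pos_def using n ab by (simp add: insert_twice_def takeWhile_neq_append)
    moreover have "pos (int n) (drop (Suc a) (insert_twice e (a, b, n))) = b - a"
      unfolding pos_def using n ab by (simp add: insert_twice_def takeWhile_neq_append)
    ultimately show ?thesis using M ab by (simp add: g_def)
  qed
  then show ?thesis
    by (intro inj_on_inverseI[where g = g]) auto
qed

lemma children_eq:
  assumes "e \<in> avoiding_inversion_seqs"
  shows "children t e =
    insert_once e ` {(a, n) \<in> once_sites e. a = t + n} \<union>
    insert_twice e ` {(a, b, n) \<in> twice_sites e. (if a = b then a + 1 else a) = t + n}"
    (is "_ = insert_once e ` ?S \<union> insert_twice e ` ?T")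
proof (intro set_eqI iffI)
  fix e' assume e': "e' \<in> children t e"
  then have "e' \<in> avoiding_inversion_seqs" "e' \<noteq> []" and p: "parent e' = e" and r: "seq_rank e' = int t"
    by (auto simp: children_def)
  then consider a n where "(a, n) \<in> once_sites e" "e' = insert_once e (a, n)"
    | a b n where "(a, b, n) \<in> twice_sites e" "e' = insert_twice e (a, b, n)"
    using avoiding_cases[of e'] by auto
  then show "e' \<in> insert_once e ` ?S \<union> insert_twice e ` ?T"
  proof cases
    case (1 a n)
    then have "int a - int n = int t" using insert_once_child(4)[OF assms] r by metis
    then have "(a, n) \<in> ?S" using 1 by auto
    then show ?thesis using 1 by blast
  next
    case (2 a b n)
    then have "(if a = b then int a + 1 else int a) - int n = int t"
      using insert_twice_child(4)[OF assms] r by metis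
    then have "(a, b, n) \<in> ?T" using 2 by (auto split: if_splits)
    then show ?thesis using 2 by blast
  qed
next
  fix e' assume "e' \<in> insert_once e ` ?S \<union> insert_twice e ` ?T"
  then consider a n where "(a, n) \<in> once_sites e" "a = t + n" "e' = insert_once e (a, n)"
    | a b n where "(a, b, n) \<in> twice_sites e" "(if a = b then a + 1 else a) = t + n"
        "e' = insert_twice e (a, b, n)"
    by auto
  then show "e' \<in> children t e"
  proof cases
    case (1 a n)
    moreover have "insert_once e (a, n) \<noteq> []" by (simp add: insert_once_def)
    ultimately show ?thesis using insert_once_child[OF assms 1(1)] by (simp add: children_def)
  next
    case (2 a b n)
    moreover have "insert_twice e (a, b, n) \<noteq> []" by (simp add: insert_twice_def)
    ultimately show ?thesis using insert_twice_child[OF assms 2(1)]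
      by (auto simp: children_def split: if_splits)
  qed
qed

section \<open>Number of children of each rank\<close>

text \<open>Lengths distinguish children with one new entry from those with two, so the two kinds
  are counted separately.\<close>

lemma length_insert_once: "length (insert_once e (a, n)) = Suc (length e)"
  by (simp add: insert_once_def)

lemma length_insert_twice: "a \<le> b \<Longrightarrow> length (insert_twice e (a, b, n)) = Suc (Suc (length e))"
  using arg_cong[OF take_drop_take_drop[of a b e], of length] by (simp add: insert_twice_def)

lemma sum_diff_choose_2: "(\<Sum>n\<in>{q..<q + k}. q + k - n) = Suc k choose 2"
proof (induction k)
  case (Suc k)
  have "(\<Sum>n\<in>{q..<q + Suc k}. q + Suc k - n) = (\<Sum>n\<in>{q..<q + k}. Suc (q + k - n)) + 1"
    by (simp add: Suc_diff_le)
  also have "\<dots> = (Suc k choose 2) + k + 1"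
    by (subst sum.distrib[of "\<lambda>n. q + k - n" "\<lambda>_. 1", simplified]) (use Suc in simp)
  also have "\<dots> = Suc (Suc k) choose 2"
    by (simp add: numeral_2_eq_2)
  finally show ?case .
qed simp

text \<open>Truncated subtraction yields 0 for \<open>t > s + 1\<close>. Rank 0 takes the value of
  rank 1 because adjacent copies never produce rank 0.\<close>

definition num_children :: "nat \<Rightarrow> nat \<Rightarrow> nat" where
  "num_children t s = (if t = 0 then (s + 2) choose 2 else (s + 3 - t) choose 2)"

lemma card_children:
  assumes "e \<in> avoiding_inversion_seqs" "seq_rank e = int s"
  shows "finite (children t e)" "card (children t e) = num_children t s"
proof -
  let ?q = "max_succ e"
  have p: "ascent_length e = ?q + s" using seq_rank_eq[OF assms(1)] assms(2) by simp
  define O1 where "O1 = {(a, n) \<in> once_sites e. a = t + n}"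
  define T where "T = {(a, b, n) \<in> twice_sites e. (if a = b then a + 1 else a) = t + n}"
  \<comment> \<open>\<open>T1\<close> collects the sites with separated copies, where
    \<open>a = t + n < b\<close>.\<close>
  define T1 where "T1 = (\<lambda>(n, b). (t + n, b, n)) ` (SIGMA n:{?q..<?q + (s - t)}. {t + n<..?q + s})"
  \<comment> \<open>\<open>T2\<close> collects the sites with adjacent copies, where
    \<open>a + 1 = t + n\<close>; at \<open>t = 0\<close> this would contradict
    \<open>n \<le> a\<close>.\<close>
  define T2 where "T2 = (if t = 0 then {} else (\<lambda>n. (t + n - 1, t + n - 1, n)) ` {?q..<?q + (s + 2 - t)})"
  have O1: "O1 = (\<lambda>n. (t + n, n)) ` {?q..<?q + (s + 1 - t)}"
    unfolding O1_def once_sites_def p by (auto simp: image_iff)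
  have cO1: "finite O1" "card O1 = s + 1 - t"
    unfolding O1 by (auto simp: card_image inj_on_def)
  have T: "T = T1 \<union> T2"
    unfolding T_def T1_def T2_def twice_sites_def p
    by (auto simp: image_iff split: if_splits; presburger)
  have disj: "T1 \<inter> T2 = {}" unfolding T1_def T2_def by auto
  have fin: "finite T1" "finite T2" unfolding T1_def T2_def by auto
  have "card T1 = (\<Sum>n\<in>{?q..<?q + (s - t)}. ?q + s - (t + n))"
    unfolding T1_def by (subst card_image) (auto simp: inj_on_def)
  also have "\<dots> = (\<Sum>n\<in>{?q..<?q + (s - t)}. ?q + (s - t) - n)"
    by (intro sum.cong) auto
  also have "\<dots> = Suc (s - t) choose 2" by (rule sum_diff_choose_2)
  finally have cT1: "card T1 = Suc (s - t) choose 2" .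
  have cT2: "card T2 = (if t = 0 then 0 else s + 2 - t)"
    unfolding T2_def by (auto simp: card_image inj_on_def)
  have cT: "finite T" "card T = (Suc (s - t) choose 2) + (if t = 0 then 0 else s + 2 - t)"
    unfolding T using fin disj cT1 cT2 by (simp_all add: card_Un_disjoint)
  have sub: "O1 \<subseteq> once_sites e" "T \<subseteq> twice_sites e" by (auto simp: O1_def T_def)
  have c: "children t e = insert_once e ` O1 \<union> insert_twice e ` T"
    unfolding O1_def T_def by (rule children_eq[OF assms(1)])
  have d: "insert_once e ` O1 \<inter> insert_twice e ` T = {}"
  proof -
    have "length x = Suc (length e)" if "x \<in> insert_once e ` O1" for x
      using that by (auto simp: length_insert_once)
    moreover have "length x = Suc (Suc (length e))" if "x \<in> insert_twice e ` T" for x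
      using that sub(2) by (auto simp: length_insert_twice twice_sites_def)
    ultimately show ?thesis by fastforce
  qed
  show "finite (children t e)" unfolding c using cO1 cT by simp
  have "card (children t e) = card O1 + card T"
    unfolding c using cO1 cT d sub inj_on_insert_once[OF assms(1)] inj_on_insert_twice[OF assms(1)]
    by (subst card_Un_disjoint) (auto simp: card_image inj_on_subset)
  \<comment> \<open>Pascal's rule adds up the sizes: once for \<open>t = 0\<close>, twice for
    \<open>0 < t \<le> s\<close>.\<close>
  also have "\<dots> = num_children t s"
  proof (cases t)
    case 0
    then show ?thesis using cO1 cT by (simp add: num_children_def numeral_2_eq_2)
  next
    case (Suc t')
    show ?thesis
    proof (cases "t \<le> s")
      case True
      then obtain k where "s = t + k" using le_Suc_ex by blast
      then show ?thesis using cO1 cT Suc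
        by (simp add: num_children_def numeral_2_eq_2 numeral_3_eq_3)
    next
      case False
      \<comment> \<open>The rank rises by at most one: for \<open>t = s + 1\<close> the only site
        puts both copies at the end of the prefix, with the least admissible value.\<close>
      then consider "t = s + 1" | "t \<ge> s + 2" by linarith
      then show ?thesis using cO1 cT Suc by cases (auto simp: num_children_def numeral_3_eq_3 binomial_eq_0)
    qed
  qed
  finally show "card (children t e) = num_children t s" .
qed

section \<open>Recursion on the number of distinct entries\<close>

definition level :: "nat \<Rightarrow> nat \<Rightarrow> int list set" where
  "level m t = {e \<in> avoiding_inversion_seqs. seq_dist e = m \<and> seq_rank e = int t}"

lemma level_0: "level 0 t = (if t = 0 then {[]} else {})"
proof -
  have "[] \<in> avoiding_inversion_seqs" by (simp add: mem_avoiding_iff avoids3_def)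
  then show ?thesis by (auto simp: level_def seq_dist_def seq_rank_def)
qed

text \<open>Deleting the maximum keeps avoidance and removes one distinct value; the rank of the
  result is a natural number \<open>s\<close>.\<close>

lemma level_Suc: "level (Suc m) t = (\<Union>s. \<Union>e\<in>level m s. children t e)"
proof (intro set_eqI iffI)
  fix e assume e: "e \<in> level (Suc m) t"
  then have ne: "e \<noteq> []" by (auto simp: level_def seq_dist_def)
  have av: "parent e \<in> avoiding_inversion_seqs" using avoiding_cases e ne by (auto simp: level_def)
  then obtain s where "seq_rank (parent e) = int s"
    using seq_rank_eq[OF av] max_succ_le_ascent_length[OF av]
    by (metis of_nat_diff)
  then have "parent e \<in> level m s" using av e seq_dist_parent[OF ne] by (auto simp: level_def)
  moreover have "e \<in> children t (parent e)" using e ne by (auto simp: level_def children_def)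
  ultimately show "e \<in> (\<Union>s. \<Union>e\<in>level m s. children t e)" by blast
next
  fix e assume "e \<in> (\<Union>s. \<Union>e\<in>level m s. children t e)"
  then show "e \<in> level (Suc m) t" by (auto simp: level_def children_def seq_dist_parent)
qed

text \<open>For \<open>t > 0\<close> the substitution \<open>s = t - 1 + i\<close> gives
  \<open>raney_convolution\<close> with \<open>j = 2\<close> and \<open>r = 3 t - 2\<close>; for
  \<open>t = 0\<close> the same identity is used with \<open>r = 1\<close>.\<close>

lemma sum_num_children_raney:
  "(\<Sum>s\<le>m. raney (m - s) (3 * s + 1) * int (num_children t s))
    = (if t \<le> Suc m then raney (Suc m - t) (3 * t + 1) else 0)"
proof (cases t)
  case 0
  have "(\<Sum>s\<le>m. raney (m - s) (3 * s + 1) * int (num_children t s)) = raney m 4"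
    using raney_convolution[where k = m and j = 2 and r = 1] 0
    by (simp add: num_children_def mult.commute eval_nat_numeral)
  \<comment> \<open>This is \<open>B = 1 + x B^4\<close> in positive degree.\<close>
  also have "\<dots> = raney (Suc m) 1"
    using raney_Suc[of m 0] raney_Suc_0[of m] by simp
  finally show ?thesis using 0 by simp
next
  case (Suc t')
  have nc: "num_children t s = (s + 2 - t') choose 2" for s
    by (simp add: num_children_def Suc)
  show ?thesis
  proof (cases "t' \<le> m")
    case True
    let ?g = "\<lambda>s. raney (m - s) (3 * s + 1) * int (num_children t s)"
    \<comment> \<open>For \<open>s < t'\<close> the top \<open>s + 2 - t'\<close> is at most 1, so
      its binomial over 2 vanishes.\<close>
    have "(\<Sum>s\<le>m. ?g s) = (\<Sum>s\<in>{t'..m}. ?g s)"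
      by (rule sum.mono_neutral_right) (auto simp: nc)
    also have "\<dots> = (\<Sum>i\<le>m - t'. ?g (t' + i))"
      using True
      by (intro sum.reindex_bij_witness[where i = "\<lambda>i. t' + i" and j = "\<lambda>s. s - t'"]) auto
    also have "\<dots> = (\<Sum>i\<le>m - t'. int ((i + 2) choose 2) * raney (m - t' - i) ((3 * t' + 1) + 3 * i))"
      by (intro sum.cong) (auto simp: nc algebra_simps)
    also have "\<dots> = raney (m - t') (3 * t' + 1 + 2 + 1)" by (rule raney_convolution)
    also have "3 * t' + 1 + 2 + 1 = 3 * t + 1" using Suc by simp
    finally show ?thesis using True Suc by simp
  next
    case False
    then have "(\<Sum>s\<le>m. raney (m - s) (3 * s + 1) * int (num_children t s)) = 0"
      by (intro sum.neutral) (auto simp: nc)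
    then show ?thesis using False Suc by simp
  qed
qed

lemma card_level:
  "finite (level m t) \<and> int (card (level m t)) = (if t \<le> m then raney (m - t) (3 * t + 1) else 0)"
proof (induction m arbitrary: t)
  case 0
  then show ?case by (simp add: level_0)
next
  case (Suc m)
  \<comment> \<open>Finiteness is carried through the induction so that cardinality 0 means empty
    here; only the ranks up to \<open>m\<close> then contribute.\<close>
  have empty: "level m s = {}" if "s > m" for s
    using Suc[of s] that by (auto simp: card_eq_0_iff)
  then have lev: "level (Suc m) t = (\<Union>s\<in>{..m}. \<Union>e\<in>level m s. children t e)"
  proof -
    have "s \<le> m" if "e \<in> level m s" for e s
      using that empty[of s] by (cases "s \<le> m") auto
    then show ?thesis unfolding level_Suc by blast
  qed
  have fin: "finite (\<Union>e\<in>level m s. children t e)" for s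
    using Suc card_children(1) by (auto simp: level_def)
  have "card (\<Union>e\<in>level m s. children t e) = card (level m s) * num_children t s" for s
  proof -
    have "card (\<Union>e\<in>level m s. children t e) = (\<Sum>e\<in>level m s. card (children t e))"
      using Suc card_children(1) by (intro card_UN_disjoint) (auto simp: level_def children_def)
    also have "\<dots> = (\<Sum>e\<in>level m s. num_children t s)"
      using card_children(2) by (intro sum.cong) (auto simp: level_def)
    finally show ?thesis by simp
  qed
  \<comment> \<open>The union is disjoint because a child determines its parent and thereby the rank
    \<open>s\<close>.\<close>
  moreover have "card (level (Suc m) t) = (\<Sum>s\<le>m. card (\<Union>e\<in>level m s. children t e))"
    unfolding lev using fin
    by (intro card_UN_disjoint) (auto simp: level_def children_def)
  ultimately have "int (card (level (Suc m) t)) = (\<Sum>s\<le>m. int (card (level m s)) * int (num_children t s))"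
    by simp
  also have "\<dots> = (\<Sum>s\<le>m. raney (m - s) (3 * s + 1) * int (num_children t s))"
    using Suc by (intro sum.cong) auto
  also note sum_num_children_raney
  finally show ?case unfolding lev using fin by (simp add: lev)
qed

theorem theorem4p4:
  "(\<forall>m t :: nat. t \<le> m \<longrightarrow>
      real (card {e \<in> avoiding_inversion_seqs. seq_dist e = m \<and> seq_rank e = int t}) =
        (3 * real t + 1) / (3 * real m + 1) * real ((4 * m - t) choose (m - t)))
   \<and> (\<forall>m :: nat.
      real (card {e \<in> avoiding_inversion_seqs. seq_dist e = m \<and> seq_rank e = 0}) =
        1 / (3 * real m + 1) * real ((4 * m) choose m))"
proof -
  have main: "real (card {e \<in> avoiding_inversion_seqs. seq_dist e = m \<and> seq_rank e = int t}) =
        (3 * real t + 1) / (3 * real m + 1) * real ((4 * m - t) choose (m - t))"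
    if "t \<le> m" for m t
  proof -
    have "int (card (level m t)) = raney (m - t) (3 * t + 1)"
      using card_level[of m t] that by simp
    then have "real_of_int (int (card (level m t))) = real_of_int (raney (m - t) (3 * t + 1))"
      by (rule arg_cong)
    then show ?thesis unfolding raney_closed_form[OF that] level_def of_int_of_nat_eq .
  qed
  moreover have "real (card {e \<in> avoiding_inversion_seqs. seq_dist e = m \<and> seq_rank e = 0}) =
        1 / (3 * real m + 1) * real ((4 * m) choose m)" for m
    using main[of 0 m] by simp
  ultimately show ?thesis by blast
qed

end
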